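(* Let $\mathcal{C}=\{\phi_1,\dots,\phi_N\}$ be a collection of $N$ vectors in $\{\pm1/\sqrt m\}^m$ that forms an orthogonal array of strength $t$, let $\Phi$ be the $m\times N$ matrix with columns $\phi_1,\dots,\phi_N$, and let $l\le t$ be an even positive integer. Let $1\le k\le N$, $\delta,\epsilon\in(0,1)$. If $$m\ge\tfrac34\,l\,\Bigl(\frac k\delta\Bigr)^2\Bigl(\frac k\epsilon\Bigr)^{2/l},$$ then $\Phi$ is $(k,\delta,\epsilon)$-StRIP.
   Context: $\mathcal{C}$ is an orthogonal array of strength $t$ if for every set of $r\le t$ coordinates in $\{1,\dots,m\}$, the restriction to these coordinates of a uniformly random element of $\mathcal{C}$ is uniformly distributed over all $2^r$ sign patterns $\{\pm1/\sqrt m\}^r$. For $I\subset[N]=\{1,\dots,N\}$, $\Phi_I$ is the submatrix of $\Phi$ with columns indexed by $I$. $\Phi$ is $(k,\delta,\epsilon)$-StRIP if, for $I$ a uniformly random $k$-subset of $[N]$, $\Pr(\|\Phi_I^T\Phi_I-\mathrm{Id}\|\le\delta)\ge1-\epsilon$, where $\|\cdot\|$ is the spectral norm. *)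

theory Defs
  imports
    "HOL-Probability.Probability_Mass_Function"
    "Jordan_Normal_Form.Matrix"
    "Jordan_Normal_Form.DL_Submatrix"
begin

unbundle no vec_syntax
no_notation inner (infix "\<bullet>" 70)

text \<open>Coordinates and column indices run over \<open>{..<m}\<close> and \<open>{..<N}\<close>. A collection
  of \<open>N\<close> vectors is a list of length \<open>N\<close>; as usual for orthogonal arrays, repeated vectors are
  allowed and count with multiplicity.\<close>

definition sign_vecs :: "nat \<Rightarrow> real vec set" where
  "sign_vecs m = {v \<in> carrier_vec m. \<forall>i<m. v $ i \<in> {1 / sqrt (real m), - 1 / sqrt (real m)}}"

text \<open>The restriction to the coordinate set \<open>S\<close> of a uniformly random entry of the list is
  uniformly distributed over the sign patterns on \<open>S\<close>. Only used for nonempty lists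
  (\<open>pmf_of_set {}\<close> is unspecified).\<close>

definition orthogonal_array :: "nat \<Rightarrow> nat \<Rightarrow> real vec list \<Rightarrow> bool" where
  "orthogonal_array m t \<phi> \<longleftrightarrow>
     (\<forall>S. S \<subseteq> {..<m} \<and> card S \<le> t \<longrightarrow>
        map_pmf (\<lambda>j. restrict (\<lambda>i. (\<phi> ! j) $ i) S) (pmf_of_set {..<length \<phi>})
          = pmf_of_set (S \<rightarrow>\<^sub>E {1 / sqrt (real m), - 1 / sqrt (real m)}))"

definition euclid_norm :: "real vec \<Rightarrow> real" where
  "euclid_norm v = sqrt (v \<bullet> v)"

definition spectral_norm :: "real mat \<Rightarrow> real" where
  "spectral_norm A =
     (SUP v \<in> {v \<in> carrier_vec (dim_col A). euclid_norm v \<le> 1}. euclid_norm (A *\<^sub>v v))"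

text \<open>The supremum is taken over a nonempty set that is bounded above, so it is not junk.\<close>

lemma spectral_norm_nonempty: "0\<^sub>v n \<in> {v \<in> carrier_vec n. euclid_norm v \<le> 1}"
  by (simp add: euclid_norm_def)

lemma spectral_norm_bdd:
  "bdd_above ((\<lambda>v. euclid_norm (A *\<^sub>v v)) ` {v \<in> carrier_vec (dim_col A). euclid_norm v \<le> 1})"
proof -
  have "euclid_norm (A *\<^sub>v v) \<le> sqrt (\<Sum>i<dim_row A. (\<Sum>j<dim_col A. \<bar>A $$ (i, j)\<bar>)\<^sup>2)"
    if v: "v \<in> carrier_vec (dim_col A)" "euclid_norm v \<le> 1" for v
  proof -
    have "v \<bullet> v \<le> 1"
      using v(2) by (simp add: euclid_norm_def)
    then have s: "(\<Sum>j<dim_col A. (v $ j)\<^sup>2) \<le> 1"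
      using v(1) by (simp add: scalar_prod_def power2_eq_square atLeast0LessThan)
    have v1: "\<bar>v $ j\<bar> \<le> 1" if "j < dim_col A" for j
    proof -
      have "(v $ j)\<^sup>2 \<le> (\<Sum>j<dim_col A. (v $ j)\<^sup>2)"
        using that by (intro member_le_sum) auto
      with s have "(v $ j)\<^sup>2 \<le> 1" by linarith
      then show ?thesis by (simp add: abs_square_le_1)
    qed
    have row: "((A *\<^sub>v v) $ i)\<^sup>2 \<le> (\<Sum>j<dim_col A. \<bar>A $$ (i, j)\<bar>)\<^sup>2"
      if "i < dim_row A" for i
    proof -
      have "\<bar>(A *\<^sub>v v) $ i\<bar> = \<bar>\<Sum>j<dim_col A. A $$ (i, j) * v $ j\<bar>"
        using that v(1) by (simp add: scalar_prod_def atLeast0LessThan)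
      also have "\<dots> \<le> (\<Sum>j<dim_col A. \<bar>A $$ (i, j) * v $ j\<bar>)"
        by (rule sum_abs)
      also have "\<dots> \<le> (\<Sum>j<dim_col A. \<bar>A $$ (i, j)\<bar>)"
        using v1 by (intro sum_mono) (simp add: abs_mult mult_left_le)
      finally show ?thesis
        by (metis abs_ge_zero power2_abs power_mono)
    qed
    have "(A *\<^sub>v v) \<bullet> (A *\<^sub>v v) = (\<Sum>i<dim_row A. ((A *\<^sub>v v) $ i)\<^sup>2)"
      by (simp only: scalar_prod_def power2_eq_square atLeast0LessThan dim_mult_mat_vec)
    also have "\<dots> \<le> (\<Sum>i<dim_row A. (\<Sum>j<dim_col A. \<bar>A $$ (i, j)\<bar>)\<^sup>2)"
      using row by (intro sum_mono) auto
    finally show ?thesis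
      by (simp add: euclid_norm_def)
  qed
  then show ?thesis
    by (intro bdd_aboveI2) auto
qed

definition cols_submatrix :: "real mat \<Rightarrow> nat set \<Rightarrow> real mat" where
  "cols_submatrix A I = submatrix A UNIV I"

text \<open>Only used for \<open>k \<le> dim_col \<Phi>\<close>, so that \<open>k\<close>-subsets of the column indices exist.\<close>

definition StRIP :: "nat \<Rightarrow> real \<Rightarrow> real \<Rightarrow> real mat \<Rightarrow> bool" where
  "StRIP k \<delta> \<epsilon> \<Phi> \<longleftrightarrow>
     measure_pmf.prob (pmf_of_set {I. I \<subseteq> {..<dim_col \<Phi>} \<and> card I = k})
       {I. spectral_norm (transpose_mat (cols_submatrix \<Phi> I) * cols_submatrix \<Phi> I - 1\<^sub>m k) \<le> \<delta>}
     \<ge> 1 - \<epsilon>"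

end

theory Submission
  imports Defs "HOL-Probability.Product_PMF"
begin

text \<open>Since the columns are unit vectors, the spectral norm of \<open>\<Phi>\<^sub>I\<^sup>T \<Phi>\<^sub>I - Id\<close> is at most the
  largest absolute row sum \<open>\<Sum>j\<in>I - {i}. \<bar>\<langle>\<phi>\<^sub>i, \<phi>\<^sub>j\<rangle>\<bar>\<close>. A union bound over the \<open>k\<close> rows, Markov's
  inequality for the \<open>l\<close>-th power and the power mean inequality bound the failure probability by
  \<open>k (k - 1)\<^sup>l \<delta>\<^sup>-\<^sup>l\<close> times the average of \<open>\<langle>\<phi>\<^sub>i, \<phi>\<^sub>j\<rangle>\<^sup>l\<close> over pairs \<open>i \<noteq> j\<close>. For fixed \<open>i\<close> this is a
  polynomial of degree \<open>l \<le> t\<close> in the entries of \<open>\<phi>\<^sub>j\<close>, so its average over \<open>j\<close> is the one for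
  independent signs, where Khintchine's bound \<open>(l - 1)!! m\<^sup>-\<^sup>l\<^sup>/\<^sup>2\<close> applies; finally
  \<open>(l - 1)!! \<le> (l / 2)\<^sup>l\<^sup>/\<^sup>2\<close>.\<close>

unbundle no vec_syntax
no_notation inner (infix "\<bullet>" 70)

section \<open>Even moments of Rademacher sums\<close>

text \<open>Odd powers of \<open>d\<close> cancel between the two expansions. Summing over the two
  signs of a new coordinate in \<open>rademacher_moment\<close> produces this expression.\<close>

lemma even_binomial:
  fixes s d :: real
  shows "(s + d) ^ (2 * n) + (s - d) ^ (2 * n) =
    2 * (\<Sum>r\<le>n. real ((2 * n) choose (2 * r)) * (d\<^sup>2) ^ r * s ^ (2 * (n - r)))"
proof -
  have "(s + d) ^ (2 * n) + (s - d) ^ (2 * n) = (d + s) ^ (2 * n) + (- d + s) ^ (2 * n)"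
    by (simp add: add.commute)
  also have "\<dots> = (\<Sum>k\<le>2 * n. real ((2 * n) choose k) * (d ^ k + (- d) ^ k) * s ^ (2 * n - k))"
    unfolding binomial_ring by (simp add: sum.distrib algebra_simps)
  also have "\<dots> = (\<Sum>k\<in>(\<lambda>r. 2 * r) ` {..n}.
      real ((2 * n) choose k) * (d ^ k + (- d) ^ k) * s ^ (2 * n - k))"
  proof (rule sum.mono_neutral_right)
    show "\<forall>i\<in>{..2 * n} - (\<lambda>r. 2 * r) ` {..n}.
        real (2 * n choose i) * (d ^ i + (- d) ^ i) * s ^ (2 * n - i) = 0"
    proof
      fix i assume i: "i \<in> {..2 * n} - (\<lambda>r. 2 * r) ` {..n}"
      have "odd i"
      proof
        assume "even i"
        then obtain r where "i = 2 * r" by blast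
        with i show False by auto
      qed
      then show "real (2 * n choose i) * (d ^ i + (- d) ^ i) * s ^ (2 * n - i) = 0" by simp
    qed
  qed auto
  also have "\<dots> = 2 * (\<Sum>r\<le>n. real ((2 * n) choose (2 * r)) * (d\<^sup>2) ^ r * s ^ (2 * (n - r)))"
    by (subst sum.reindex)
      (auto simp: inj_on_def sum_distrib_left power_mult right_diff_distrib' intro!: sum.cong)
  finally show ?thesis .
qed

text \<open>The even factors of \<open>fact (2 * r)\<close> multiply to
  \<open>2 ^ r * fact r\<close>, and its odd factors are all at least 1.\<close>

lemma fact_mult_power2_le_fact_double: "2 ^ r * fact r \<le> (fact (2 * r) :: real)"
proof (induction r)
  case (Suc r)
  have "2 ^ Suc r * fact (Suc r) = (2 * real r + 2) * (2 ^ r * fact r)"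
    by (simp add: algebra_simps)
  also have "\<dots> \<le> (2 * real r + 2) * ((2 * real r + 1) * fact (2 * r))"
    using order.trans[OF Suc, of "(2 * real r + 1) * fact (2 * r)"]
    by (intro mult_left_mono) (auto simp: mult_le_cancel_right1)
  also have "\<dots> = fact (2 * Suc r)"
    by (simp add: algebra_simps)
  finally show ?case .
qed simp

text \<open>This is the double factorial \<open>(2 n - 1)!!\<close>, the \<open>2 n\<close>-th moment of a standard Gaussian.\<close>

definition rademacher_const :: "nat \<Rightarrow> real" where
  "rademacher_const n = fact (2 * n) / (2 ^ n * fact n)"

lemma rademacher_const_pos: "rademacher_const n > 0"
  by (simp add: rademacher_const_def)

text \<open>After cancelling common factorials, only \<open>2 ^ r * fact r <= fact (2 * r)\<close>
  remains. The estimate trades the coefficients of \<open>even_binomial\<close> for those of an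
  ordinary binomial expansion of degree \<open>n\<close>.\<close>

lemma rademacher_const_binomial:
  assumes "r \<le> n"
  shows "real ((2 * n) choose (2 * r)) * rademacher_const (n - r)
    \<le> real (n choose r) * rademacher_const n"
proof -
  have e: "2 * n - 2 * r = 2 * (n - r)" by simp
  have p: "(2::real) ^ n = 2 ^ r * 2 ^ (n - r)"
    using assms by (simp flip: power_add)
  have "real ((2 * n) choose (2 * r)) * rademacher_const (n - r)
      = fact (2 * n) / (2 ^ (n - r) * fact (n - r)) * (1 / fact (2 * r))"
    using assms by (simp add: rademacher_const_def binomial_fact[of "2 * r" "2 * n"] e)
  also have "\<dots> \<le> fact (2 * n) / (2 ^ (n - r) * fact (n - r)) * (1 / (2 ^ r * fact r))"
    using fact_mult_power2_le_fact_double[of r]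
    by (intro mult_left_mono divide_left_mono) (auto intro!: mult_pos_pos)
  also have "\<dots> = real (n choose r) * rademacher_const n"
    using assms by (simp add: rademacher_const_def binomial_fact[of r n] p)
  finally show ?thesis .
qed

text \<open>Passing from \<open>n\<close> to \<open>n + 1\<close> multiplies the constant by
  \<open>2 * n + 1\<close>, while for positive \<open>n\<close> the right-hand side grows by a
  factor of at least \<open>2 * (n + 1)\<close>.\<close>

lemma rademacher_const_le: "rademacher_const n \<le> real n ^ n"
proof (induction n)
  case (Suc n)
  show ?case
  proof (cases "n = 0")
    case False
    \<comment> \<open>Bernoulli at \<open>1 / n\<close> gives \<open>1 + n * (1 / n) = 2\<close>;
      this is why \<open>n = 0\<close> is split off.\<close>
    have "2 \<le> (1 + 1 / real n) ^ n"
      using Bernoulli_inequality[of "1 / real n" n] False order.trans[of "-1" 0 "1 / real n"] by auto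
    then have "2 * real n ^ n \<le> (1 + 1 / real n) ^ n * real n ^ n"
      by (intro mult_right_mono) auto
    also have "\<dots> = (real n + 1) ^ n"
      using False by (simp flip: power_mult_distrib add: field_simps)
    finally have two: "2 * real n ^ n \<le> (real n + 1) ^ n" .
    have "rademacher_const (Suc n) = (2 * real n + 1) * rademacher_const n"
      by (simp add: rademacher_const_def divide_simps)
    also have "\<dots> \<le> (2 * real n + 1) * real n ^ n"
      using Suc by (intro mult_left_mono) auto
    also have "\<dots> \<le> (real n + 1) * (2 * real n ^ n)"
      by (simp add: algebra_simps)
    also have "\<dots> \<le> (real n + 1) * (real n + 1) ^ n"
      using two by (intro mult_left_mono) auto
    finally show ?thesis by (simp add: algebra_simps)
  qed (simp add: rademacher_const_def)
qed (simp add: rademacher_const_def)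

lemma sum_PiE_insert:
  assumes "i \<notin> S"
  shows "(\<Sum>x\<in>insert i S \<rightarrow>\<^sub>E E. g x) = (\<Sum>x\<in>S \<rightarrow>\<^sub>E E. \<Sum>y\<in>E. g (x(i := y)))"
proof -
  have "(\<Sum>x\<in>insert i S \<rightarrow>\<^sub>E E. g x) = (\<Sum>(y, x)\<in>E \<times> (S \<rightarrow>\<^sub>E E). g (x(i := y)))"
    unfolding PiE_insert_eq
    by (subst sum.reindex[OF inj_combinator[OF assms]]) (simp add: case_prod_unfold)
  also have "\<dots> = (\<Sum>y\<in>E. \<Sum>x\<in>S \<rightarrow>\<^sub>E E. g (x(i := y)))"
    by (simp add: sum.cartesian_product)
  also have "\<dots> = (\<Sum>x\<in>S \<rightarrow>\<^sub>E E. \<Sum>y\<in>E. g (x(i := y)))"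
    by (rule sum.swap)
  finally show ?thesis .
qed

text \<open>Khintchine's inequality with the Gaussian constant, left unnormalised:
  \<open>2 ^ card S\<close> counts the sign patterns and \<open>card S * v\<close> is the variance
  of the sum. The induction splits off one coordinate; \<open>n\<close> stays arbitrary because the
  expansion involves the lower moments \<open>n - r\<close>.\<close>

lemma rademacher_moment:
  fixes a v :: real and c :: "'i \<Rightarrow> real"
  assumes "finite S" and "a \<noteq> 0" and "\<And>i. i \<in> S \<Longrightarrow> (c i * a)\<^sup>2 = v" and "0 \<le> v"
  shows "(\<Sum>x\<in>S \<rightarrow>\<^sub>E {a, - a}. (\<Sum>i\<in>S. x i * c i) ^ (2 * n))
    \<le> 2 ^ card S * rademacher_const n * (real (card S) * v) ^ n"
  using assms(1,3)
proof (induction S arbitrary: n rule: finite_induct)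
  case empty
  \<comment> \<open>The empty sum to the power \<open>2 * n\<close> is 1 for \<open>n = 0\<close>
    and 0 otherwise, matching \<open>0 ^ n\<close> on the right.\<close>
  show ?case by (cases n) (simp_all add: rademacher_const_def)
next
  case (insert i S)
  let ?E = "{a, - a}"
  let ?s = "\<lambda>x. \<Sum>i\<in>S. x i * c i"
  have v: "(a * c i)\<^sup>2 = v" using insert.prems[of i] by (simp add: mult.commute)
  have upd: "(\<Sum>j\<in>insert i S. (x(i := y)) j * c j) = ?s x + y * c i" for x y
  proof -
    have "(\<Sum>j\<in>S. (x(i := y)) j * c j) = ?s x"
      using insert.hyps by (intro sum.cong) auto
    then show ?thesis using insert.hyps by simp
  qed
  have "(\<Sum>x\<in>insert i S \<rightarrow>\<^sub>E ?E. (\<Sum>j\<in>insert i S. x j * c j) ^ (2 * n))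
      = (\<Sum>x\<in>S \<rightarrow>\<^sub>E ?E. \<Sum>y\<in>?E. (?s x + y * c i) ^ (2 * n))"
    unfolding sum_PiE_insert[OF insert.hyps(2)] upd ..
  \<comment> \<open>Since \<open>a \<noteq> 0\<close>, the two signs are distinct and the sum over
    the set \<open>?E\<close> really has two terms.\<close>
  also have "\<dots> = (\<Sum>x\<in>S \<rightarrow>\<^sub>E ?E. (?s x + a * c i) ^ (2 * n) + (?s x - a * c i) ^ (2 * n))"
    using \<open>a \<noteq> 0\<close> by simp
  also have "\<dots> = (\<Sum>x\<in>S \<rightarrow>\<^sub>E ?E. \<Sum>r\<le>n. 2 * (real ((2 * n) choose (2 * r)) * v ^ r * ?s x ^ (2 * (n - r))))"
    unfolding even_binomial v by (simp add: sum_distrib_left)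
  also have "\<dots> = (\<Sum>r\<le>n. 2 * real ((2 * n) choose (2 * r)) * v ^ r * (\<Sum>x\<in>S \<rightarrow>\<^sub>E ?E. ?s x ^ (2 * (n - r))))"
    by (subst sum.swap) (simp add: sum_distrib_left mult.assoc)
  also have "\<dots> \<le> (\<Sum>r\<le>n. 2 * real ((2 * n) choose (2 * r)) * v ^ r *
      (2 ^ card S * rademacher_const (n - r) * (real (card S) * v) ^ (n - r)))"
    using insert.prems \<open>0 \<le> v\<close> by (intro sum_mono mult_left_mono insert.IH) auto
  also have "\<dots> = (\<Sum>r\<le>n. (real ((2 * n) choose (2 * r)) * rademacher_const (n - r)) *
      (2 ^ Suc (card S) * v ^ r * (real (card S) * v) ^ (n - r)))"
    by (simp add: mult_ac)
  also have "\<dots> \<le> (\<Sum>r\<le>n. (real (n choose r) * rademacher_const n) *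
      (2 ^ Suc (card S) * v ^ r * (real (card S) * v) ^ (n - r)))"
    using \<open>0 \<le> v\<close> by (intro sum_mono mult_right_mono rademacher_const_binomial) auto
  \<comment> \<open>The binomial theorem reassembles the sum; \<open>v + card S * v\<close> is the
    variance with one more coordinate.\<close>
  also have "\<dots> = 2 ^ Suc (card S) * rademacher_const n * (v + real (card S) * v) ^ n"
    unfolding binomial_ring by (simp add: sum_distrib_left mult_ac)
  finally show ?case
    using insert.hyps by (simp add: algebra_simps)
qed

section \<open>Averages over an orthogonal array\<close>

text \<open>The uniform distribution on a finite function space is a product of uniform
  distributions, and a marginal of a product is the product of the remaining factors.\<close>

lemma map_restrict_pmf_of_set_PiE:
  assumes "finite T" and "S \<subseteq> T" and "finite E" and "E \<noteq> {}"
  shows "map_pmf (\<lambda>x. restrict x S) (pmf_of_set (T \<rightarrow>\<^sub>E E)) = pmf_of_set (S \<rightarrow>\<^sub>E E)"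
proof -
  have eq: "PiE_dflt A undefined (\<lambda>_. E) = (A \<rightarrow>\<^sub>E E)" for A :: "'a set"
    by (auto simp: PiE_dflt_def PiE_iff extensional_def)
  have fin: "finite S" using assms finite_subset by blast
  have "pmf_of_set (S \<rightarrow>\<^sub>E E) = Pi_pmf S undefined (\<lambda>_. pmf_of_set E)"
    using assms fin by (subst Pi_pmf_of_set) (auto simp: eq)
  also have "\<dots> = map_pmf (\<lambda>x. restrict x S) (Pi_pmf T undefined (\<lambda>_. pmf_of_set E))"
    unfolding Pi_pmf_subset[OF assms(1,2)] by (simp add: restrict_def)
  also have "Pi_pmf T undefined (\<lambda>_. pmf_of_set E) = pmf_of_set (T \<rightarrow>\<^sub>E E)"
    using assms by (subst Pi_pmf_of_set) (auto simp: eq)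
  finally show ?thesis ..
qed

text \<open>As \<open>g\<close> sees only the coordinates in \<open>S\<close>, both sides are its
  mean over uniform patterns on \<open>S\<close>. Writing that mean over all \<open>m\<close>
  coordinates gives monomials with different supports a common sample space.\<close>

lemma orthogonal_array_average:
  fixes g :: "(nat \<Rightarrow> real) \<Rightarrow> real"
  assumes oa: "orthogonal_array m t \<phi>" and "S \<subseteq> {..<m}" and "card S \<le> t"
    and g: "\<And>x. g (restrict x S) = g x" and "0 < m" and "\<phi> \<noteq> []"
  shows "(\<Sum>j<length \<phi>. g (\<lambda>i. (\<phi> ! j) $ i)) / real (length \<phi>)
    = (\<Sum>x\<in>{..<m} \<rightarrow>\<^sub>E {1 / sqrt (real m), - 1 / sqrt (real m)}. g x) / 2 ^ m"
proof -
  let ?E = "{1 / sqrt (real m), - 1 / sqrt (real m)}"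
  have cE: "card ?E = 2" using \<open>0 < m\<close> by auto
  have ne: "({..<m} \<rightarrow>\<^sub>E ?E) \<noteq> {}" by (auto simp: PiE_eq_empty_iff)
  have "(\<Sum>j<length \<phi>. g (\<lambda>i. (\<phi> ! j) $ i)) / real (length \<phi>)
      = measure_pmf.expectation (pmf_of_set {..<length \<phi>}) (\<lambda>j. g (restrict (\<lambda>i. (\<phi> ! j) $ i) S))"
    using \<open>\<phi> \<noteq> []\<close> by (subst integral_pmf_of_set) (simp_all only: g finite_lessThan lessThan_empty_iff card_lessThan length_0_conv simp_thms)
  also have "\<dots> = measure_pmf.expectation
      (map_pmf (\<lambda>j. restrict (\<lambda>i. (\<phi> ! j) $ i) S) (pmf_of_set {..<length \<phi>})) g"
    by (rule integral_map_pmf[symmetric])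
  also have "map_pmf (\<lambda>j. restrict (\<lambda>i. (\<phi> ! j) $ i) S) (pmf_of_set {..<length \<phi>})
      = pmf_of_set (S \<rightarrow>\<^sub>E ?E)"
    using oa assms(2,3) unfolding orthogonal_array_def by blast
  also have "\<dots> = map_pmf (\<lambda>x. restrict x S) (pmf_of_set ({..<m} \<rightarrow>\<^sub>E ?E))"
    by (rule map_restrict_pmf_of_set_PiE[symmetric]) (use assms in auto)
  also have "measure_pmf.expectation \<dots> g
      = measure_pmf.expectation (pmf_of_set ({..<m} \<rightarrow>\<^sub>E ?E)) (\<lambda>x. g (restrict x S))"
    by (rule integral_map_pmf)
  also have "\<dots> = (\<Sum>x\<in>{..<m} \<rightarrow>\<^sub>E ?E. g x) / real (card ({..<m} \<rightarrow>\<^sub>E ?E))"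
    unfolding g by (rule integral_pmf_of_set[OF ne]) (simp add: finite_PiE)
  also have "card ({..<m} \<rightarrow>\<^sub>E ?E) = 2 ^ m"
    by (simp only: card_funcsetE[OF finite_lessThan] cE card_lessThan)
  finally show ?thesis by simp
qed

text \<open>Here \<open>f\<close> records which summand is taken from each of the \<open>l\<close>
  factors. Indexing monomials this way avoids multinomial coefficients, and the image of
  \<open>f\<close> is the set of coordinates involved.\<close>

lemma power_sum_eq_sum_PiE:
  fixes x c :: "'i \<Rightarrow> real"
  assumes "finite T"
  shows "(\<Sum>i\<in>T. x i * c i) ^ l
    = (\<Sum>f\<in>{..<l} \<rightarrow>\<^sub>E T. (\<Prod>a<l. c (f a)) * (\<Prod>a<l. x (f a)))"
  using prod_sum_PiE[of "{..<l}" "\<lambda>_. T" "\<lambda>_ i. x i * c i"] assms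
  by (simp add: prod.distrib mult.commute)

lemma orthogonal_array_moment:
  assumes oa: "orthogonal_array m t \<phi>" and "l \<le> t" and "0 < m" and "\<phi> \<noteq> []"
  shows "(\<Sum>j<length \<phi>. (\<Sum>i<m. (\<phi> ! j) $ i * c i) ^ l) / real (length \<phi>)
    = (\<Sum>x\<in>{..<m} \<rightarrow>\<^sub>E {1 / sqrt (real m), - 1 / sqrt (real m)}. (\<Sum>i<m. x i * c i) ^ l) / 2 ^ m"
proof -
  txt \<open>A monomial of degree \<open>l\<close> involves at most \<open>l \<le> t\<close> coordinates, so strength \<open>t\<close> determines its average.\<close>
  let ?F = "{..<l} \<rightarrow>\<^sub>E {..<m}" let ?N = "real (length \<phi>)"
  let ?P = "{..<m} \<rightarrow>\<^sub>E {1 / sqrt (real m), - 1 / sqrt (real m)}"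
  have av: "(\<Sum>j<length \<phi>. \<Prod>a<l. (\<phi> ! j) $ f a) / ?N = (\<Sum>x\<in>?P. \<Prod>a<l. x (f a)) / 2 ^ m"
    if "f \<in> ?F" for f
  proof (rule orthogonal_array_average[OF oa, of "f ` {..<l}"])
    show "card (f ` {..<l}) \<le> t"
      using card_image_le[of "{..<l}" f] \<open>l \<le> t\<close> by simp
  qed (use that assms in auto)
  have "(\<Sum>j<length \<phi>. (\<Sum>i<m. (\<phi> ! j) $ i * c i) ^ l) / ?N
      = (\<Sum>f\<in>?F. (\<Prod>a<l. c (f a)) * ((\<Sum>j<length \<phi>. \<Prod>a<l. (\<phi> ! j) $ f a) / ?N))"
    unfolding power_sum_eq_sum_PiE[OF finite_lessThan]
    by (subst sum.swap) (simp add: sum_distrib_left sum_divide_distrib)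
  also have "\<dots> = (\<Sum>f\<in>?F. (\<Prod>a<l. c (f a)) * ((\<Sum>x\<in>?P. \<Prod>a<l. x (f a)) / 2 ^ m))"
    by (intro sum.cong refl) (simp only: av)
  also have "\<dots> = (\<Sum>x\<in>?P. (\<Sum>i<m. x i * c i) ^ l) / 2 ^ m"
    unfolding power_sum_eq_sum_PiE[OF finite_lessThan]
    by (subst sum.swap[where A = ?P and B = ?F]) (simp add: sum_distrib_left sum_divide_distrib)
  finally show ?thesis .
qed

text \<open>Each product \<open>x i * c i\<close> has square \<open>1 / m^2\<close>, so the
  \<open>m\<close> summands have total variance \<open>1 / m\<close>, whose \<open>n\<close>-th
  power enters Khintchine's bound.\<close>

lemma orthogonal_array_moment_bound:
  assumes oa: "orthogonal_array m t \<phi>" and "2 * n \<le> t" and "0 < m" and "\<phi> \<noteq> []"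
    and c: "\<And>i. i < m \<Longrightarrow> c i \<in> {1 / sqrt (real m), - 1 / sqrt (real m)}"
  shows "(\<Sum>j<length \<phi>. (\<Sum>i<m. (\<phi> ! j) $ i * c i) ^ (2 * n)) / real (length \<phi>)
    \<le> rademacher_const n / real m ^ n"
proof -
  let ?a = "1 / sqrt (real m)"
  have "(\<Sum>j<length \<phi>. (\<Sum>i<m. (\<phi> ! j) $ i * c i) ^ (2 * n)) / real (length \<phi>)
    = (\<Sum>x\<in>{..<m} \<rightarrow>\<^sub>E {?a, - ?a}. (\<Sum>i<m. x i * c i) ^ (2 * n)) / 2 ^ m"
    using orthogonal_array_moment[OF oa assms(2-4), of c] by simp
  also have "\<dots> \<le> 2 ^ m * rademacher_const n * (real m * (1 / (real m)\<^sup>2)) ^ n / 2 ^ m"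
  proof (intro divide_right_mono)
    have "(c i * ?a)\<^sup>2 = 1 / (real m)\<^sup>2" if "i < m" for i
      using c[OF that] by (auto simp: power2_eq_square)
    then show "(\<Sum>x\<in>{..<m} \<rightarrow>\<^sub>E {?a, - ?a}. (\<Sum>i<m. x i * c i) ^ (2 * n))
      \<le> 2 ^ m * rademacher_const n * (real m * (1 / (real m)\<^sup>2)) ^ n"
      using rademacher_moment[of "{..<m}" ?a c "1 / (real m)\<^sup>2" n] \<open>0 < m\<close> by simp
  qed simp
  also have "\<dots> = rademacher_const n / real m ^ n"
    using \<open>0 < m\<close> by (simp add: power2_eq_square power_divide)
  finally show ?thesis .
qed

section \<open>From row sums to the spectral norm\<close>

lemma scalar_prod_self: "v \<bullet> v = (\<Sum>i<dim_vec v. (v $ i)\<^sup>2)" for v :: "real vec"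
  by (simp add: scalar_prod_def power2_eq_square atLeast0LessThan)

lemma spectral_norm_le_row_sum:
  assumes A: "A \<in> carrier_mat k k"
    and sym: "\<And>i j. i < k \<Longrightarrow> j < k \<Longrightarrow> A $$ (i, j) = A $$ (j, i)"
    and row: "\<And>i. i < k \<Longrightarrow> (\<Sum>j<k. \<bar>A $$ (i, j)\<bar>) \<le> \<delta>" and "0 \<le> \<delta>"
  shows "spectral_norm A \<le> \<delta>"
  unfolding spectral_norm_def
proof (rule cSUP_least)
  show "{v \<in> carrier_vec (dim_col A). euclid_norm v \<le> 1} \<noteq> {}"
    using spectral_norm_nonempty by blast
  fix v assume "v \<in> {v \<in> carrier_vec (dim_col A). euclid_norm v \<le> 1}"
  then have v: "dim_vec v = k" and v1: "(\<Sum>j<k. (v $ j)\<^sup>2) \<le> 1"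
    using A scalar_prod_self[of v] by (auto simp: euclid_norm_def)
  txt \<open>Schur's test: Cauchy-Schwarz with the weight \<open>\<bar>A\<^sub>i\<^sub>j\<bar>\<close> split evenly between both factors.\<close>
  have "((A *\<^sub>v v) $ i)\<^sup>2 \<le> \<delta> * (\<Sum>j<k. \<bar>A $$ (i, j)\<bar> * (v $ j)\<^sup>2)" if i: "i < k" for i
  proof -
    have "(A *\<^sub>v v) $ i = (\<Sum>j<k. A $$ (i, j) * v $ j)"
      using A i v by (simp add: scalar_prod_def atLeast0LessThan)
    also have "\<bar>\<dots>\<bar> \<le> (\<Sum>j<k. sqrt \<bar>A $$ (i, j)\<bar> * (sqrt \<bar>A $$ (i, j)\<bar> * \<bar>v $ j\<bar>))"
      by (rule order.trans[OF sum_abs]) (simp add: abs_mult flip: mult.assoc)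
    finally have "((A *\<^sub>v v) $ i)\<^sup>2
        \<le> (\<Sum>j<k. sqrt \<bar>A $$ (i, j)\<bar> * (sqrt \<bar>A $$ (i, j)\<bar> * \<bar>v $ j\<bar>))\<^sup>2"
      by (rule power2_le_iff_abs_le[THEN iffD2, rotated]) (auto intro!: sum_nonneg)
    also have "\<dots> \<le> (\<Sum>j<k. (sqrt \<bar>A $$ (i, j)\<bar>)\<^sup>2) * (\<Sum>j<k. (sqrt \<bar>A $$ (i, j)\<bar> * \<bar>v $ j\<bar>)\<^sup>2)"
      by (rule Cauchy_Schwarz_ineq_sum)
    also have "\<dots> = (\<Sum>j<k. \<bar>A $$ (i, j)\<bar>) * (\<Sum>j<k. \<bar>A $$ (i, j)\<bar> * (v $ j)\<^sup>2)"
      by (simp add: power_mult_distrib)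
    also have "\<dots> \<le> \<delta> * (\<Sum>j<k. \<bar>A $$ (i, j)\<bar> * (v $ j)\<^sup>2)"
      using row[OF i] by (intro mult_right_mono sum_nonneg) auto
    finally show ?thesis .
  qed
  then have "(\<Sum>i<k. ((A *\<^sub>v v) $ i)\<^sup>2) \<le> (\<Sum>i<k. \<delta> * (\<Sum>j<k. \<bar>A $$ (i, j)\<bar> * (v $ j)\<^sup>2))"
    by (intro sum_mono) auto
  \<comment> \<open>After the interchange of sums, symmetry turns column sums of absolute values
    into row sums, so \<open>row\<close> applies a second time.\<close>
  also have "\<dots> = \<delta> * (\<Sum>j<k. (v $ j)\<^sup>2 * (\<Sum>i<k. \<bar>A $$ (j, i)\<bar>))"
    by (subst sum_distrib_left[symmetric], subst sum.swap)
      (auto simp: sum_distrib_left mult.commute sym intro!: sum.cong arg_cong[where f = "(*) \<delta>"])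
  also have "\<dots> \<le> \<delta> * (\<Sum>j<k. (v $ j)\<^sup>2 * \<delta>)"
    using row \<open>0 \<le> \<delta>\<close> by (intro mult_left_mono sum_mono) auto
  also have "\<dots> = \<delta>\<^sup>2 * (\<Sum>j<k. (v $ j)\<^sup>2)"
    by (simp add: power2_eq_square sum_distrib_left mult_ac)
  also have "\<dots> \<le> \<delta>\<^sup>2"
    using v1 by (simp add: mult_left_le)
  finally show "euclid_norm (A *\<^sub>v v) \<le> \<delta>"
    using A \<open>0 \<le> \<delta>\<close> unfolding euclid_norm_def scalar_prod_self
    by (simp add: real_le_lsqrt)
qed

text \<open>\<open>submatrix\<close> numbers the columns in \<open>I\<close> through
  \<open>pick I\<close>; the bijection converts sums over \<open>{..<k}\<close> into sums over
  \<open>I\<close>.\<close>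

lemma bij_betw_pick:
  assumes "finite I"
  shows "bij_betw (pick I) {..<card I} I"
proof -
  have "inj_on (pick I) {..<card I}"
    by (rule linorder_inj_onI) (auto dest: pick_mono_le)
  moreover have "pick I ` {..<card I} \<subseteq> I"
    using pick_in_set_le by auto
  moreover have "card (pick I ` {..<card I}) = card I"
    using calculation(1) by (simp add: card_image)
  ultimately show ?thesis
    using assms by (auto simp: bij_betw_def card_subset_eq)
qed

text \<open>Unit columns put 1 on the diagonal of the Gram matrix, so subtracting the identity
  leaves only the inner products of distinct columns.\<close>

lemma spectral_norm_gram_deviation_le:
  assumes I: "I \<subseteq> {..<dim_col \<Phi>}" "card I = k"
    and unit: "\<And>i. i \<in> I \<Longrightarrow> col \<Phi> i \<bullet> col \<Phi> i = 1"
    and row: "\<And>i. i \<in> I \<Longrightarrow> (\<Sum>j\<in>I - {i}. \<bar>col \<Phi> i \<bullet> col \<Phi> j\<bar>) \<le> \<delta>" and "0 \<le> \<delta>"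
  shows "spectral_norm (transpose_mat (cols_submatrix \<Phi> I) * cols_submatrix \<Phi> I - 1\<^sub>m k) \<le> \<delta>"
proof -
  let ?M = "cols_submatrix \<Phi> I"
  let ?B = "transpose_mat ?M * ?M - 1\<^sub>m k"
  have fin: "finite I" using I(1) finite_subset by blast
  have bij: "bij_betw (pick I) {..<k} I"
    using bij_betw_pick[OF fin] I(2) by simp
  \<comment> \<open>\<open>dim_submatrix\<close> gives the number of columns as this
    cardinality.\<close>
  have cI: "card {j. j < dim_col \<Phi> \<and> j \<in> I} = k"
    using I by (auto intro!: arg_cong[where f = card] simp flip: I(2))
  have dims: "?M \<in> carrier_mat (dim_row \<Phi>) k"
    using cI by (auto simp: cols_submatrix_def dim_submatrix)
  have colM: "col ?M i = col \<Phi> (pick I i)" if "i < k" for i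
  proof (rule eq_vecI)
    fix a assume "a < dim_vec (col \<Phi> (pick I i))"
    moreover have "pick I i < dim_col \<Phi>"
      using bij I(1) that by (auto simp: bij_betw_def)
    ultimately show "col ?M i $ a = col \<Phi> (pick I i) $ a"
      using dims that cI by (simp add: cols_submatrix_def submatrix_index pick_UNIV)
  qed (use dims in auto)
  have B: "?B $$ (i, j) = (if i = j then 0 else col \<Phi> (pick I i) \<bullet> col \<Phi> (pick I j))"
    if "i < k" "j < k" for i j
  proof -
    have "pick I i \<in> I" using bij that by (auto simp: bij_betw_def)
    then show ?thesis using dims that unit by (auto simp: colM)
  qed
  have s: "col \<Phi> i \<bullet> col \<Phi> j = col \<Phi> j \<bullet> col \<Phi> i" for i j
    by (rule comm_scalar_prod[of _ "dim_row \<Phi>"]) auto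
  show ?thesis
  proof (rule spectral_norm_le_row_sum[of _ k])
    show "?B \<in> carrier_mat k k" using dims by auto
    show "?B $$ (i, j) = ?B $$ (j, i)" if "i < k" "j < k" for i j
      using that s[of "pick I i"] by (simp only: B split: if_split) simp
    fix i assume i: "i < k"
    let ?i = "pick I i"
    have iI: "?i \<in> I" using bij i by (auto simp: bij_betw_def)
    \<comment> \<open>The zero is placed by the test \<open>pick I j = ?i\<close> instead of
      \<open>i = j\<close>, which makes the summand a function of \<open>pick I j\<close> and allows
      reindexing along the bijection.\<close>
    have "(\<Sum>j<k. \<bar>?B $$ (i, j)\<bar>)
        = (\<Sum>j<k. if pick I j = ?i then 0 else \<bar>col \<Phi> ?i \<bullet> col \<Phi> (pick I j)\<bar>)"
    proof (rule sum.cong[OF refl])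
      fix j assume "j \<in> {..<k}"
      then have j: "j < k" by simp
      have "pick I j = ?i \<longleftrightarrow> i = j"
        using i j bij by (auto simp: bij_betw_def inj_on_eq_iff)
      then show "\<bar>?B $$ (i, j)\<bar> = (if pick I j = ?i then 0 else \<bar>col \<Phi> ?i \<bullet> col \<Phi> (pick I j)\<bar>)"
        unfolding B[OF i j] by simp
    qed
    also have "\<dots> = (\<Sum>j\<in>I. if j = ?i then 0 else \<bar>col \<Phi> ?i \<bullet> col \<Phi> j\<bar>)"
      by (rule sum.reindex_bij_betw[OF bij])
    also have "\<dots> = (\<Sum>j\<in>I - {?i}. \<bar>col \<Phi> ?i \<bullet> col \<Phi> j\<bar>)"
      by (subst sum.remove[OF fin iI]) (auto intro: sum.cong)
    finally show "(\<Sum>j<k. \<bar>?B $$ (i, j)\<bar>) \<le> \<delta>"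
      using row[OF iI] by simp
  qed fact
qed

section \<open>Counting subsets with a large row sum\<close>

text \<open>Deleting \<open>T\<close> is a bijection onto the subsets of \<open>V - T\<close> of
  size \<open>k - card T\<close>.\<close>

lemma card_subsets_containing:
  assumes "finite V" and "T \<subseteq> V" and "card T \<le> k"
  shows "card {I. I \<subseteq> V \<and> card I = k \<and> T \<subseteq> I} = (card V - card T) choose (k - card T)"
proof -
  have T: "finite T" using assms finite_subset by blast
  have "bij_betw (\<lambda>I. I - T) {I. I \<subseteq> V \<and> card I = k \<and> T \<subseteq> I}
      {J. J \<subseteq> V - T \<and> card J = k - card T}"
  proof (rule bij_betwI[where g = "\<lambda>J. J \<union> T"])
    show "(\<lambda>J. J \<union> T) \<in> {J. J \<subseteq> V - T \<and> card J = k - card T}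
        \<rightarrow> {I. I \<subseteq> V \<and> card I = k \<and> T \<subseteq> I}"
    proof
      fix J assume J: "J \<in> {J. J \<subseteq> V - T \<and> card J = k - card T}"
      have "finite J" using J assms(1) finite_subset[of J V] by blast
      then have "card (J \<union> T) = card J + card T"
        using J T by (intro card_Un_disjoint) auto
      then show "J \<union> T \<in> {I. I \<subseteq> V \<and> card I = k \<and> T \<subseteq> I}"
        using J assms by auto
    qed
  qed (auto simp: card_Diff_subset T)
  then have "card {I. I \<subseteq> V \<and> card I = k \<and> T \<subseteq> I} = card (V - T) choose (k - card T)"
    using assms by (simp add: bij_betw_same_card n_subsets)
  then show ?thesis
    using assms T by (simp add: card_Diff_subset)
qed

text \<open>Double counting: every ordered pair of distinct elements lies in the same number of
  \<open>k\<close>-subsets.\<close>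

lemma sum_subsets_pairs:
  fixes h :: "'a \<Rightarrow> 'a \<Rightarrow> real"
  assumes V: "finite V" and k: "2 \<le> k"
  shows "(\<Sum>I | I \<subseteq> V \<and> card I = k. \<Sum>i\<in>I. \<Sum>j\<in>I - {i}. h i j)
    = real ((card V - 2) choose (k - 2)) * (\<Sum>i\<in>V. \<Sum>j\<in>V - {i}. h i j)"
proof -
  let ?P = "{I. I \<subseteq> V \<and> card I = k}"
  have fP: "finite ?P" using V by simp
  have "(\<Sum>I\<in>?P. \<Sum>i\<in>I. \<Sum>j\<in>I - {i}. h i j)
      = (\<Sum>I\<in>?P. \<Sum>i\<in>V. \<Sum>j\<in>V - {i}. if {i, j} \<subseteq> I then h i j else 0)"
  proof (rule sum.cong[OF refl])
    fix I assume I: "I \<in> ?P"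
    have "(\<Sum>i\<in>V. \<Sum>j\<in>V - {i}. if {i, j} \<subseteq> I then h i j else 0)
        = (\<Sum>i\<in>I. \<Sum>j\<in>V - {i}. if {i, j} \<subseteq> I then h i j else 0)"
      by (rule sum.mono_neutral_right) (use V I in auto)
    also have "\<dots> = (\<Sum>i\<in>I. \<Sum>j\<in>I - {i}. if {i, j} \<subseteq> I then h i j else 0)"
      by (rule sum.cong[OF refl], rule sum.mono_neutral_right) (use V I in auto)
    also have "\<dots> = (\<Sum>i\<in>I. \<Sum>j\<in>I - {i}. h i j)"
      by (rule sum.cong[OF refl], rule sum.cong[OF refl]) auto
    finally show "(\<Sum>i\<in>I. \<Sum>j\<in>I - {i}. h i j)
        = (\<Sum>i\<in>V. \<Sum>j\<in>V - {i}. if {i, j} \<subseteq> I then h i j else 0)" ..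
  qed
  also have "\<dots> = (\<Sum>i\<in>V. \<Sum>j\<in>V - {i}. \<Sum>I\<in>?P. if {i, j} \<subseteq> I then h i j else 0)"
    by (rule trans[OF sum.swap], rule sum.cong[OF refl], rule sum.swap)
  also have "\<dots> = (\<Sum>i\<in>V. \<Sum>j\<in>V - {i}. real ((card V - 2) choose (k - 2)) * h i j)"
  proof (intro sum.cong refl)
    fix i j assume ij: "i \<in> V" "j \<in> V - {i}"
    have "(\<Sum>I\<in>?P. if {i, j} \<subseteq> I then h i j else 0)
        = real (card {I \<in> ?P. {i, j} \<subseteq> I}) * h i j"
      by (simp only: sum.inter_filter[OF fP, symmetric] sum_constant)
    also have "{I \<in> ?P. {i, j} \<subseteq> I} = {I. I \<subseteq> V \<and> card I = k \<and> {i, j} \<subseteq> I}"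
      by blast
    also have "card \<dots> = (card V - 2) choose (k - 2)"
    proof -
      have "card {i, j} = 2" using ij by auto
      then show ?thesis using card_subsets_containing[OF V, of "{i, j}" k] ij k by simp
    qed
    finally show "(\<Sum>I\<in>?P. if {i, j} \<subseteq> I then h i j else 0)
        = real ((card V - 2) choose (k - 2)) * h i j" .
  qed
  finally show ?thesis by (simp add: sum_distrib_left)
qed

text \<open>Jensen's inequality with equal weights; evenness of \<open>l\<close> gives convexity and
  removes the absolute values on the right.\<close>

lemma power_sum_abs_le:
  fixes x :: "'a \<Rightarrow> real"
  assumes "finite A" and "even l" and "0 < l"
  shows "(\<Sum>i\<in>A. \<bar>x i\<bar>) ^ l \<le> real (card A) ^ (l - 1) * (\<Sum>i\<in>A. x i ^ l)"
proof (cases "A = {}")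
  case False
  let ?c = "real (card A)"
  have c: "?c > 0" using False assms by (simp add: card_gt_0_iff)
  have "(\<Sum>i\<in>A. (1 / ?c) *\<^sub>R \<bar>x i\<bar>) ^ l \<le> (\<Sum>i\<in>A. (1 / ?c) * \<bar>x i\<bar> ^ l)"
    using convex_on_sum[OF \<open>finite A\<close> False convex_power_even[OF \<open>even l\<close>],
        of "\<lambda>_. 1 / ?c" "\<lambda>i. \<bar>x i\<bar>"] c by simp
  then have "(\<Sum>i\<in>A. \<bar>x i\<bar>) ^ l / ?c ^ l \<le> (\<Sum>i\<in>A. x i ^ l) / ?c"
    using \<open>even l\<close> by (simp add: power_divide power_even_abs flip: sum_divide_distrib)
  moreover have "?c ^ l = ?c ^ (l - 1) * ?c"
    using \<open>0 < l\<close> by (cases l) auto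
  ultimately show ?thesis
    using c by (simp add: field_simps)
qed (use assms in \<open>simp add: zero_power\<close>)

text \<open>Markov's inequality in counting form, multiplied out so that nothing is divided by
  \<delta> or by the number of subsets.\<close>

lemma card_large_row_sum_le:
  fixes G :: "'a \<Rightarrow> 'a \<Rightarrow> real"
  assumes V: "finite V" and l: "even l" "0 < l" and k: "1 \<le> k" and "0 \<le> \<delta>" and "0 \<le> \<mu>"
    and moment: "\<And>i. i \<in> V \<Longrightarrow> (\<Sum>j\<in>V - {i}. G i j ^ l) \<le> (real (card V) - 1) * \<mu>"
  shows "real (card {I. I \<subseteq> V \<and> card I = k \<and> (\<exists>i\<in>I. \<delta> < (\<Sum>j\<in>I - {i}. \<bar>G i j\<bar>))}) * \<delta> ^ l
    \<le> real k * (real k - 1) ^ l * \<mu> * real (card V choose k)"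
\<comment> \<open>For \<open>k = 1\<close> there are no off-diagonal entries and both sides are 0;
  the pair count below needs \<open>2 <= k\<close>.\<close>
proof (cases "k = 1")
  case True
  have "{I. I \<subseteq> V \<and> card I = k \<and> (\<exists>i\<in>I. \<delta> < (\<Sum>j\<in>I - {i}. \<bar>G i j\<bar>))} = {}"
  proof -
    have "(\<Sum>j\<in>I - {i}. \<bar>G i j\<bar>) = 0" if "card I = k" "i \<in> I" for I i
      using that True by (auto simp: card_1_singleton_iff)
    then show ?thesis using \<open>0 \<le> \<delta>\<close> by force
  qed
  then show ?thesis using True l by (simp only:) (simp add: zero_power)
next
  case False
  with k have k: "2 \<le> k" by simp
  let ?P = "{I. I \<subseteq> V \<and> card I = k}"
  let ?row = "\<lambda>I i. \<Sum>j\<in>I - {i}. \<bar>G i j\<bar>"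
  let ?bad = "{I. I \<subseteq> V \<and> card I = k \<and> (\<exists>i\<in>I. \<delta> < ?row I i)}"
  let ?N = "card V"
  have fI: "finite I" if "I \<in> ?P" for I using that V finite_subset by blast
  have row_nonneg: "0 \<le> ?row I i ^ l" for I i by (intro zero_le_power sum_nonneg) simp
  have "real (card ?bad) * \<delta> ^ l = (\<Sum>I\<in>?bad. \<delta> ^ l)" by simp
  \<comment> \<open>Markov and union bound at once: one large row already contributes
    \<open>\<delta> ^ l\<close>, and the other rows contribute nonnegative amounts.\<close>
  also have "\<dots> \<le> (\<Sum>I\<in>?bad. \<Sum>i\<in>I. ?row I i ^ l)"
  proof (rule sum_mono)
    fix I assume "I \<in> ?bad"
    then obtain i where i: "I \<in> ?P" "i \<in> I" "\<delta> < ?row I i" by blast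
    have "\<delta> ^ l \<le> ?row I i ^ l" using i(3) \<open>0 \<le> \<delta>\<close> by (intro power_mono) simp_all
    also have "\<dots> \<le> (\<Sum>i\<in>I. ?row I i ^ l)"
      by (rule member_le_sum[OF i(2) row_nonneg fI[OF i(1)]])
    finally show "\<delta> ^ l \<le> (\<Sum>i\<in>I. ?row I i ^ l)" .
  qed
  also have "\<dots> \<le> (\<Sum>I\<in>?P. \<Sum>i\<in>I. ?row I i ^ l)"
  proof (rule sum_mono2)
    show "finite ?P" using V by simp
    show "?bad \<subseteq> ?P" by blast
    show "0 \<le> (\<Sum>i\<in>I. ?row I i ^ l)" for I by (rule sum_nonneg) (rule row_nonneg)
  qed
  also have "\<dots> \<le> (\<Sum>I\<in>?P. \<Sum>i\<in>I. (real k - 1) ^ (l - 1) * (\<Sum>j\<in>I - {i}. G i j ^ l))"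
  proof (intro sum_mono)
    fix I i assume I: "I \<in> ?P" "i \<in> I"
    have "real (card (I - {i})) = real k - 1"
      using I fI[OF I(1)] k by (simp add: of_nat_diff)
    then show "?row I i ^ l \<le> (real k - 1) ^ (l - 1) * (\<Sum>j\<in>I - {i}. G i j ^ l)"
      using power_sum_abs_le[OF _ l, of "I - {i}" "G i"] fI[OF I(1)] by simp
  qed
  also have "\<dots> = (real k - 1) ^ (l - 1) *
      (real ((?N - 2) choose (k - 2)) * (\<Sum>i\<in>V. \<Sum>j\<in>V - {i}. G i j ^ l))"
    unfolding sum_subsets_pairs[OF V k, symmetric] by (simp add: sum_distrib_left)
  also have "\<dots> \<le> (real k - 1) ^ (l - 1) *
      (real ((?N - 2) choose (k - 2)) * (\<Sum>i\<in>V. (real ?N - 1) * \<mu>))"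
    using k by (intro mult_left_mono sum_mono moment) auto
  also have "\<dots> = (real k - 1) ^ (l - 1) * \<mu> * (real ?N * (real ?N - 1) * real ((?N - 2) choose (k - 2)))"
    by simp
  \<comment> \<open>Both sides count \<open>k\<close>-subsets with an ordered pair of distinct
    elements marked in them. For \<open>?N < 2\<close> both vanish because \<open>2 <= k\<close>;
    otherwise the truncated subtractions are exact.\<close>
  also have "real ?N * (real ?N - 1) * real ((?N - 2) choose (k - 2))
      = real k * (real k - 1) * real (?N choose k)"
  proof (cases "?N < 2")
    case False
    have "k * (?N choose k) = ?N * ((?N - 1) choose (k - 1))"
      using k by (intro times_binomial_minus1_eq) auto
    moreover have "(k - 1) * ((?N - 1) choose (k - 1)) = (?N - 1) * ((?N - 2) choose (k - 2))"
      using k times_binomial_minus1_eq[of "k - 1" "?N - 1"] by (simp add: numeral_2_eq_2)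
    ultimately have a: "real k * real (?N choose k) = real ?N * real ((?N - 1) choose (k - 1))"
      and b: "real (k - 1) * real ((?N - 1) choose (k - 1)) = real (?N - 1) * real ((?N - 2) choose (k - 2))"
      by (metis of_nat_mult)+
    have k1: "real (k - 1) = real k - 1" and N1: "real (?N - 1) = real ?N - 1"
      using k False by (auto simp: of_nat_diff)
    have "real ?N * (real ?N - 1) * real ((?N - 2) choose (k - 2))
        = real ?N * (real (k - 1) * real ((?N - 1) choose (k - 1)))"
      by (simp only: b N1 mult.assoc)
    also have "\<dots> = real (k - 1) * (real k * real (?N choose k))"
      by (simp only: a mult.left_commute)
    finally show ?thesis by (simp only: k1 mult_ac)
  next
    case True
    then have "?N = 0 \<or> ?N = 1" by auto
    then show ?thesis using k by auto
  qed
  also have "(real k - 1) ^ (l - 1) * \<mu> * (real k * (real k - 1) * real (?N choose k))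
      = real k * ((real k - 1) ^ (l - 1) * (real k - 1)) * \<mu> * real (?N choose k)"
    by simp
  also have "(real k - 1) ^ (l - 1) * (real k - 1) = (real k - 1) ^ l"
    using l by (cases l) auto
  finally show ?thesis .
qed

section \<open>The StRIP property\<close>

text \<open>The hypothesis \<open>bound\<close> says that the failure proportion resulting from
  \<open>card_large_row_sum_le\<close> is at most \<epsilon>. This separates the probabilistic
  argument from the numerical estimate on \<open>m\<close>.\<close>

lemma orthogonal_array_StRIP:
  assumes len: "length \<phi> = N" and sgn: "set \<phi> \<subseteq> sign_vecs m"
    and oa: "orthogonal_array m t \<phi>" and n: "0 < n" "2 * n \<le> t" and "0 < m"
    and k: "1 \<le> k" "k \<le> N" and "0 < \<delta>"
    and bound: "real k * (real k - 1) ^ (2 * n) * (rademacher_const n / real m ^ n) \<le> \<epsilon> * \<delta> ^ (2 * n)"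
  shows "StRIP k \<delta> \<epsilon> (mat_of_cols m \<phi>)"
proof -
  let ?\<Phi> = "mat_of_cols m \<phi>" and ?E = "{1 / sqrt (real m), - 1 / sqrt (real m)}"
  let ?G = "\<lambda>i j. col ?\<Phi> i \<bullet> col ?\<Phi> j" and ?\<mu> = "rademacher_const n / real m ^ n"
  let ?P = "{I. I \<subseteq> {..<N} \<and> card I = k}"
  let ?good = "{I. spectral_norm (transpose_mat (cols_submatrix ?\<Phi> I) * cols_submatrix ?\<Phi> I - 1\<^sub>m k) \<le> \<delta>}"
  let ?bad = "{I. I \<subseteq> {..<N} \<and> card I = k \<and> (\<exists>i\<in>I. \<delta> < (\<Sum>j\<in>I - {i}. \<bar>?G i j\<bar>))}"
  have N: "0 < N" using k by simp
  have mem: "\<phi> ! i \<in> carrier_vec m" "\<And>a. a < m \<Longrightarrow> (\<phi> ! i) $ a \<in> ?E" if "i < N" for i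
    using subsetD[OF sgn nth_mem[of i \<phi>]] that unfolding len sign_vecs_def by simp_all
  have col: "col ?\<Phi> i = \<phi> ! i" if "i < N" for i
    using that len mem(1) by (intro col_mat_of_cols) auto
  have G: "?G i j = (\<Sum>a<m. (\<phi> ! j) $ a * (\<phi> ! i) $ a)" if "i < N" "j < N" for i j
    using mem(1)[OF that(1)] mem(1)[OF that(2)]
    by (simp add: col that scalar_prod_def atLeast0LessThan mult.commute)
  have abs: "\<bar>(\<phi> ! i) $ a\<bar> = 1 / sqrt (real m)" if "i < N" "a < m" for i a
    using mem(2)[OF that] by (elim insertE emptyE) simp_all
  have prod: "\<bar>(\<phi> ! j) $ a * (\<phi> ! i) $ a\<bar> = 1 / real m" if "i < N" "j < N" "a < m" for i j a
    unfolding abs_mult abs[OF that(1,3)] abs[OF that(2,3)] by simp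
  have unit: "?G i i = 1" if "i < N" for i
  proof -
    have "?G i i = (\<Sum>a<m. 1 / real m)"
      unfolding G[OF that that]
    proof (rule sum.cong[OF refl])
      fix a assume "a \<in> {..<m}"
      then have "\<bar>(\<phi> ! i) $ a * (\<phi> ! i) $ a\<bar> = 1 / real m"
        by (intro prod[OF that that]) simp
      then show "(\<phi> ! i) $ a * (\<phi> ! i) $ a = 1 / real m" by simp
    qed
    then show ?thesis using \<open>0 < m\<close> by simp
  qed
  have G1: "\<bar>?G i j\<bar> \<le> 1" if "i < N" "j < N" for i j
  proof -
    have "\<bar>?G i j\<bar> \<le> (\<Sum>a<m. \<bar>(\<phi> ! j) $ a * (\<phi> ! i) $ a\<bar>)"
      unfolding G[OF that] by (rule sum_abs)
    also have "\<dots> = (\<Sum>a<m. 1 / real m)"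
      by (rule sum.cong[OF refl]) (rule prod[OF that], simp)
    finally show ?thesis using \<open>0 < m\<close> by simp
  qed
  have moment: "(\<Sum>j\<in>{..<N} - {i}. ?G i j ^ (2 * n)) \<le> (real (card {..<N}) - 1) * ?\<mu>"
    if "i \<in> {..<N}" for i
  proof -
    \<comment> \<open>The array controls only the average over all \<open>N\<close> columns, with
      \<open>j = i\<close> included.\<close>
    define av where "av = (\<Sum>j<N. ?G i j ^ (2 * n)) / real N"
    have i: "i < N" using that by simp
    have "av = (\<Sum>j<length \<phi>. (\<Sum>a<m. (\<phi> ! j) $ a * (\<phi> ! i) $ a) ^ (2 * n)) / real (length \<phi>)"
      unfolding av_def len using i by (simp add: G del: power_mult)
    also have "\<dots> \<le> ?\<mu>"
      by (rule orthogonal_array_moment_bound[OF oa n(2) \<open>0 < m\<close> _ mem(2)[OF i]])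
        (use N len in auto)
    finally have "av \<le> ?\<mu>" .
    have "(\<Sum>j<N. ?G i j ^ (2 * n)) \<le> (\<Sum>j<N. 1)"
      using G1[OF i] by (intro sum_mono) (simp add: power_mult abs_square_le_1 power_le_one)
    then have "av \<le> 1" using N by (simp add: av_def)
    txt \<open>The diagonal term \<open>1\<close> is at least the average \<open>av\<close>, so removing it does not increase the average.\<close>
    have "(\<Sum>j\<in>{..<N} - {i}. ?G i j ^ (2 * n)) = real N * av - 1"
      using i N sum.remove[of "{..<N}" i "\<lambda>j. ?G i j ^ (2 * n)"] unit[OF i] by (simp add: av_def)
    also have "\<dots> \<le> (real N - 1) * av"
      using \<open>av \<le> 1\<close> by (simp add: algebra_simps)
    also have "\<dots> \<le> (real N - 1) * ?\<mu>"
      using \<open>av \<le> ?\<mu>\<close> N by (intro mult_left_mono) auto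
    finally show ?thesis by simp
  qed
  have \<mu>: "0 \<le> ?\<mu>" using rademacher_const_pos[of n] by simp
  have "real (card ?bad) * \<delta> ^ (2 * n)
      \<le> real k * (real k - 1) ^ (2 * n) * ?\<mu> * real (card {..<N} choose k)"
    by (rule card_large_row_sum_le[OF finite_lessThan _ _ k(1) _ \<mu> moment])
      (use n \<open>0 < \<delta>\<close> in simp_all)
  also have "\<dots> \<le> \<epsilon> * \<delta> ^ (2 * n) * real (N choose k)"
    unfolding card_lessThan by (rule mult_right_mono[OF bound]) simp
  also have "\<dots> = \<epsilon> * real (N choose k) * \<delta> ^ (2 * n)"
    by (simp only: mult_ac)
  finally have bad: "real (card ?bad) \<le> \<epsilon> * real (N choose k)"
    by (rule mult_right_le_imp_le) (use \<open>0 < \<delta>\<close> in simp)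
  have cP: "card ?P = N choose k" using n_subsets[of "{..<N}" k] by simp
  have fP: "finite ?P" by simp
  have pos: "0 < N choose k" using k by simp
  have neP: "?P \<noteq> {}" using pos cP by (metis card.empty less_irrefl)
  have dim: "dim_col ?\<Phi> = N" using len by simp
  have sub: "?bad \<subseteq> ?P" by blast
  \<comment> \<open>Since \<open>?bad\<close> tests row sums and not the norm itself, it may also
    contain good subsets; an inclusion suffices.\<close>
  have "?P - ?bad \<subseteq> ?P \<inter> ?good"
  proof
    fix I assume I: "I \<in> ?P - ?bad"
    then have IN: "I \<subseteq> {..<N}" "card I = k" by blast+
    have row: "(\<Sum>j\<in>I - {i}. \<bar>?G i j\<bar>) \<le> \<delta>" if "i \<in> I" for i
      using I that by (simp only: Diff_iff mem_Collect_eq) (meson not_less)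
    have "spectral_norm (transpose_mat (cols_submatrix ?\<Phi> I) * cols_submatrix ?\<Phi> I - 1\<^sub>m k) \<le> \<delta>"
    proof (rule spectral_norm_gram_deviation_le)
      show "?G i i = 1" if "i \<in> I" for i
        using unit that IN(1) by blast
    qed (use dim IN row \<open>0 < \<delta>\<close> in simp_all)
    then show "I \<in> ?P \<inter> ?good" using I by blast
  qed
  then have "card (?P - ?bad) \<le> card (?P \<inter> ?good)"
    using fP by (intro card_mono finite_Int) simp_all
  moreover have "card (?P - ?bad) = (N choose k) - card ?bad"
    using card_Diff_subset[OF finite_subset[OF sub fP] sub] by (simp only: cP)
  ultimately have "real (N choose k) - real (card ?bad) \<le> real (card (?P \<inter> ?good))"
    by linarith
  with bad have "(1 - \<epsilon>) * real (N choose k) \<le> real (card (?P \<inter> ?good))"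
    unfolding left_diff_distrib mult_1 by linarith
  then have "1 - \<epsilon> \<le> measure_pmf.prob (pmf_of_set ?P) ?good"
    unfolding measure_pmf_of_set[OF neP fP] cP using pos by (subst pos_le_divide_eq) simp_all
  then show ?thesis unfolding StRIP_def dim .
qed

theorem theorem5p4:
  fixes \<phi> :: "real vec list" and \<Phi> :: "real mat"
    and m N t l k :: nat and \<delta> \<epsilon> :: real
  assumes "length \<phi> = N"
    and "set \<phi> \<subseteq> sign_vecs m"
    and "orthogonal_array m t \<phi>"
    and "\<Phi> = mat_of_cols m \<phi>"
    and "even l" and "0 < l" and "l \<le> t"
    and "1 \<le> k" and "k \<le> N"
    and "0 < \<delta>" and "\<delta> < 1" and "0 < \<epsilon>" and "\<epsilon> < 1"
    and "real m \<ge> 3 / 4 * real l * (real k / \<delta>)\<^sup>2 * (real k / \<epsilon>) powr (2 / real l)"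
  shows "StRIP k \<delta> \<epsilon> \<Phi>"
proof -
  obtain n where n: "l = 2 * n" using \<open>even l\<close> by blast
  then have n0: "0 < n" using \<open>0 < l\<close> by simp
  let ?K = "real k" and ?p = "(real k / \<epsilon>) powr (1 / real n)"
  let ?b = "real n * (?K / \<delta>)\<^sup>2 * ?p"
  have K: "1 \<le> ?K" using \<open>1 \<le> k\<close> by simp
  have b: "0 < ?b" using n0 K \<open>0 < \<delta>\<close> \<open>0 < \<epsilon>\<close> by simp
  \<comment> \<open>The factor \<open>n\<close> inside \<open>?b\<close> will absorb
    \<open>rademacher_const n <= n ^ n\<close> once \<open>n\<close>-th powers are taken.\<close>
  have "3 / 4 * real l * (?K / \<delta>)\<^sup>2 * (?K / \<epsilon>) powr (2 / real l) = 3 / 2 * ?b"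
    by (simp add: n)
  then have m: "?b \<le> real m" using assms(14) b by linarith
  with b have m0: "0 < m" by simp
  \<comment> \<open>The exponent \<open>2 / l\<close> equals \<open>1 / n\<close>, so the
    \<open>n\<close>-th power removes the root.\<close>
  have "?p ^ n = ?K / \<epsilon>"
    using n0 K \<open>0 < \<epsilon>\<close> by (simp add: powr_power)
  then have "real n ^ n * (?K ^ (2 * n) / \<delta> ^ (2 * n)) * (?K / \<epsilon>) = ?b ^ n"
    by (simp only: power_mult_distrib power_divide flip: power_mult)
  also have "?b ^ n \<le> real m ^ n" using m b by (intro power_mono) auto
  finally have M: "real n ^ n * (?K ^ (2 * n) / \<delta> ^ (2 * n)) * (?K / \<epsilon>) \<le> real m ^ n" .
  \<comment> \<open>The constant is bounded by \<open>n ^ n\<close> and \<open>k - 1\<close> by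
    \<open>k\<close>; the factor \<open>\<epsilon> * \<delta> ^ (2 * n)\<close> is then split off to
    expose the left-hand side of \<open>M\<close>.\<close>
  have "?K * (?K - 1) ^ (2 * n) * rademacher_const n \<le> ?K * ?K ^ (2 * n) * real n ^ n"
    using K rademacher_const_le[of n] rademacher_const_pos[of n]
    by (intro mult_mono power_mono) auto
  also have "\<dots> = real n ^ n * (?K ^ (2 * n) / \<delta> ^ (2 * n)) * (?K / \<epsilon>) * (\<epsilon> * \<delta> ^ (2 * n))"
    using \<open>0 < \<delta>\<close> \<open>0 < \<epsilon>\<close> by simp
  also have "\<dots> \<le> real m ^ n * (\<epsilon> * \<delta> ^ (2 * n))"
    using M \<open>0 < \<delta>\<close> \<open>0 < \<epsilon>\<close> by (intro mult_right_mono) auto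
  finally have "?K * (?K - 1) ^ (2 * n) * (rademacher_const n / real m ^ n) \<le> \<epsilon> * \<delta> ^ (2 * n)"
    using m0 by (simp add: pos_divide_le_eq mult.commute)
  then show ?thesis
    unfolding \<open>\<Phi> = _\<close>
    using assms n n0 m0 by (intro orthogonal_array_StRIP[of \<phi> N m t n]) auto
qed

end
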